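(* Let $N=pq$, where $p$ and $q$ are distinct primes with $p\ge3$. Let $(m,a)\in\mathbb N\times\mathbb Z$ be such that $1<m<p$. Let $r\in\{1,\ldots,m-1\}$ be the residue of $p$ modulo $m$. Then the following properties hold. (1) There exist unique integers $c_{i,j}\in q\mathbb Z$ indexed by $(i,j)\in\mathbb I_{m,r}$ such that in $\mathbb Z[X,Y]$ $$(X+Y)^N-(X^q+Y^q)^p\equiv\sum_{(i,j)\in\mathbb I_{m,r}}c_{i,j}X^iY^j\pmod{J_{m,r;a}}.$$ (2) If $(X+Y)^N-a^q\in I_{m,r,N;a}$, then (with the integers $c_{i,j}$ of part (1)) in $\mathbb Z[X,Y]$ $$(X+Y)^N-X^N-Y^N\equiv\sum_{(i,j)\in\mathbb I_{m,r}}c_{i,j}X^iY^j\pmod{I_{m,r,N;a}}.$$ (3) If $(X+Y)^N-a^q\in I_{m,r,N;a}$ and $(X+Y)^N-X^N-Y^N\notin I_{m,r,N;a}$, then there exists a pair $(i_0,j_0)\in\mathbb I_{m,r}$ such that $\gcd(c_{i_0,j_0},N)=q$.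
   Context: $\mathbb N$ is the set of positive integers. $\mathbb I_{m,r}:=\{0,\ldots,m-1\}\times\{0,\ldots,r-1\}$. Ideals of $\mathbb Z[X,Y]$: $J_{m,r;a}:=(X^m-1,X^r+Y^r-a)$ and $I_{m,r,N;a}:=(X^m-1,Y^m-1,X^r+Y^r-a,N)$. *)

theory Defs
  imports
    "HOL-Computational_Algebra.Computational_Algebra"
    "HOL-Number_Theory.Cong"
    "HOL-Library.FuncSet"
begin

text \<open>
  The ring \<open>\<int>[X,Y]\<close> is rendered as \<open>\<int>[X][Y]\<close>, i.e. as the type \<^typ>\<open>int poly poly\<close>:
  the inner indeterminate is \<open>X\<close> and the outer one is \<open>Y\<close>.
\<close>

type_synonym int_poly2 = "int poly poly"

definition varX :: int_poly2 where
  "varX = [:[:0, 1:]:]"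

definition varY :: int_poly2 where
  "varY = [:0, 1:]"

text \<open>
  A commutative ring is a module over itself, and its submodules are its ideals; the ideal
  generated by a set is therefore its span, i.e. the set of finite \<open>R\<close>-linear combinations.
\<close>

definition ideal_gen :: "'a::comm_ring_1 set \<Rightarrow> 'a set" where
  "ideal_gen = module.span (*)"

lemma module_self: "module ((*) :: 'a::comm_ring_1 \<Rightarrow> 'a \<Rightarrow> 'a)"
  by unfold_locales (simp_all add: algebra_simps)

definition index_set :: "nat \<Rightarrow> nat \<Rightarrow> (nat \<times> nat) set" where
  "index_set m r = {0..<m} \<times> {0..<r}"

definition ideal_J :: "nat \<Rightarrow> nat \<Rightarrow> int \<Rightarrow> int_poly2 set" where
  "ideal_J m r a = ideal_gen {varX ^ m - 1, varX ^ r + varY ^ r - of_int a}"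

definition ideal_I :: "nat \<Rightarrow> nat \<Rightarrow> nat \<Rightarrow> int \<Rightarrow> int_poly2 set" where
  "ideal_I m r N a =
     ideal_gen {varX ^ m - 1, varY ^ m - 1, varX ^ r + varY ^ r - of_int a, of_nat N}"

definition coeff_sum :: "nat \<Rightarrow> nat \<Rightarrow> (nat \<times> nat \<Rightarrow> int) \<Rightarrow> int_poly2" where
  "coeff_sum m r c = (\<Sum>(i, j)\<in>index_set m r. of_int (c (i, j)) * varX ^ i * varY ^ j)"

text \<open>
  The condition of part (1) on a family of coefficients. The family is taken in the extensional
  function space \<open>\<rightarrow>\<^sub>E\<close>, so that equality of functions is equality of families on the index set
  and existence of a unique function expresses uniqueness of the family; the target is \<open>q\<int>\<close>.
\<close>

definition is_coeff_family ::
  "nat \<Rightarrow> nat \<Rightarrow> nat \<Rightarrow> nat \<Rightarrow> nat \<Rightarrow> int \<Rightarrow> (nat \<times> nat \<Rightarrow> int) \<Rightarrow> bool" where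
  "is_coeff_family p q N m r a c \<longleftrightarrow>
     c \<in> index_set m r \<rightarrow>\<^sub>E {z. int q dvd z} \<and>
     (varX + varY) ^ N - (varX ^ q + varY ^ q) ^ p - coeff_sum m r c \<in> ideal_J m r a"

end

theory Submission
  imports Defs
begin

text \<open>
  Reducing by the polynomial \<open>Y\<^sup>r + X\<^sup>r - a\<close>, monic in \<open>Y\<close>, and then by \<open>X\<^sup>m - 1\<close> shows that the
  quotient by \<open>J\<close> is free over \<open>\<int>\<close> on the monomials indexed by \<open>index_set m r\<close>; since
  \<open>(X + Y)\<^sup>N - (X\<^sup>q + Y\<^sup>q)\<^sup>p\<close> is \<open>q\<close> times a polynomial, this gives (1).
  For (2), the polynomial \<open>E = (X\<^sup>q + Y\<^sup>q)\<^sup>p - X\<^sup>N - Y\<^sup>N\<close> is divisible by \<open>p\<close>, while modulo \<open>q\<close> and \<open>I\<close>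
  it is \<open>(X + Y)\<^sup>N - (X\<^sup>p + Y\<^sup>p)\<^sup>q = a\<^sup>q - a\<^sup>q = 0\<close>, because \<open>X\<^sup>p + Y\<^sup>p = X\<^sup>r + Y\<^sup>r = a\<close>; as \<open>p\<close> and
  \<open>q\<close> are coprime and \<open>p q \<in> I\<close>, \<open>E \<in> I\<close>.
  For (3), if no coefficient has greatest common divisor \<open>q\<close> with \<open>N\<close>, all of them are multiples of
  \<open>N\<close>, so the sum lies in \<open>I\<close>, contrary to (2).
\<close>

section \<open>Calculus of generated ideals\<close>

lemma ideal_gen_base: "x \<in> S \<Longrightarrow> x \<in> ideal_gen S"
  unfolding ideal_gen_def by (rule module.span_base[OF module_self])

lemma ideal_gen_add: "x \<in> ideal_gen S \<Longrightarrow> y \<in> ideal_gen S \<Longrightarrow> x + y \<in> ideal_gen S"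
  unfolding ideal_gen_def by (rule module.span_add[OF module_self])

lemma ideal_gen_diff: "x \<in> ideal_gen S \<Longrightarrow> y \<in> ideal_gen S \<Longrightarrow> x - y \<in> ideal_gen S"
  unfolding ideal_gen_def by (rule module.span_diff[OF module_self])

lemma ideal_gen_mult: "x \<in> ideal_gen S \<Longrightarrow> c * x \<in> ideal_gen S"
  unfolding ideal_gen_def by (rule module.span_scale[OF module_self])

lemma ideal_gen_dvd: "x \<in> ideal_gen S \<Longrightarrow> x dvd y \<Longrightarrow> y \<in> ideal_gen S"
  by (metis dvdE ideal_gen_mult mult.commute)

lemma ideal_gen_mono: "S \<subseteq> T \<Longrightarrow> ideal_gen S \<subseteq> ideal_gen T"
  unfolding ideal_gen_def by (rule module.span_mono[OF module_self])

lemma ideal_gen_insert: "x \<in> ideal_gen (insert u S) \<longleftrightarrow> (\<exists>s. x - s * u \<in> ideal_gen S)"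
  unfolding ideal_gen_def by (auto simp: module.span_insert[OF module_self])

text \<open>Explicit cofactors turn membership in \<open>ideal_J\<close> into a polynomial identity,
  to which degree arguments apply.\<close>

lemma ideal_gen_pair: "x \<in> ideal_gen {u, v} \<longleftrightarrow> (\<exists>s t. x = s * u + t * v)"
proof -
  have "y \<in> ideal_gen {} \<longleftrightarrow> y = 0" for y :: 'a
    unfolding ideal_gen_def by (simp add: module.span_empty[OF module_self])
  then show ?thesis
    by (simp add: ideal_gen_insert algebra_simps)
qed

section \<open>Power congruences modulo a prime\<close>

lemma diff_dvd_power_diff: "x - y dvd x ^ n - (y :: 'a::comm_ring_1) ^ n"
  by (metis dvd_triv_left power_diff_sumr2)

text \<open>Once the two extreme terms of the binomial expansion are removed, every remaining
  binomial coefficient is a multiple of \<open>p\<close>.\<close>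

lemma prime_dvd_add_power_diff:
  fixes x y :: "'a::comm_ring_1"
  assumes "prime p"
  shows "of_nat p dvd (x + y) ^ p - (x ^ p + y ^ p)"
proof -
  have p: "p > 0"
    using assms by (simp add: prime_gt_0_nat)
  have "{..p} = insert 0 (insert p {1..<p})"
    by auto
  then have "(x + y) ^ p - (x ^ p + y ^ p)
      = (\<Sum>k\<in>{1..<p}. of_nat (p choose k) * x ^ k * y ^ (p - k))"
    using p by (simp add: binomial_ring)
  moreover have "of_nat p dvd (of_nat (p choose k) :: 'a)" if "k \<in> {1..<p}" for k
  proof -
    have "p dvd (p choose k)"
      using that assms by (intro dvd_choose_prime) auto
    then obtain l where "p choose k = p * l"
      by (rule dvdE)
    then show ?thesis
      by simp
  qed
  ultimately show ?thesis
    by (auto intro!: dvd_sum dvd_mult2)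
qed

section \<open>Monic division and normal forms modulo \<open>ideal_J\<close>\<close>

lemma monic_division:
  fixes f g :: "'a::idom poly"
  assumes "lead_coeff g = 1" and "degree g > 0"
  obtains s h where "f = g * s + h" and "degree h < degree g"
proof -
  obtain s h where sh: "pseudo_divmod f g = (s, h)"
    by fastforce
  \<comment> \<open>Pseudo-division scales \<open>f\<close> by a power of the leading coefficient,
    here 1. A zero remainder also has smaller degree, because \<open>g\<close> is not
    constant.\<close>
  have "g \<noteq> 0"
    using assms by auto
  from pseudo_divmod[OF this sh] assms have "f = g * s + h" "degree h < degree g"
    by auto
  then show ?thesis
    by (rule that)
qed

text \<open>Used at two levels: over the integers for \<open>X^m - 1\<close>, and over
  \<open>int poly\<close> for the other generator of \<open>ideal_J\<close>, seen as a polynomial in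
  Y.\<close>

lemma
  fixes b :: "'a::idom"
  assumes "n > 0"
  shows degree_monom_plus_const: "degree ([:0, 1:] ^ n + [:b:]) = n"
    and lead_coeff_monom_plus_const: "lead_coeff ([:0, 1:] ^ n + [:b:]) = 1"
proof -
  have *: "[:0, 1:] ^ n = monom (1::'a) n"
    by (simp add: monom_altdef)
  have "degree [:b:] < degree (monom (1::'a) n)"
    using assms by (simp add: degree_monom_eq)
  then show deg: "degree ([:0, 1:] ^ n + [:b:]) = n"
    by (simp add: * degree_add_eq_left degree_monom_eq)
  show "lead_coeff ([:0, 1:] ^ n + [:b:]) = 1"
    unfolding deg using assms by (simp add: * coeff_pCons split: nat.split)
qed

lemma varX_power_minus_one: "varX ^ m - 1 = [:[:0, 1:] ^ m + [:-1:]:]"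
  by (simp add: varX_def poly_const_pow one_pCons)

lemma ideal_J_generator:
  "varX ^ r + varY ^ r - of_int a = [:0, 1:] ^ r + [:[:0, 1:] ^ r - of_int a:]"
proof -
  have "(of_int a :: int_poly2) = [:of_int a:]"
    by (simp add: of_int_poly)
  then show ?thesis
    by (simp add: varX_def varY_def poly_const_pow)
qed

lemma coeff_sum_diff: "coeff_sum m r c - coeff_sum m r d = coeff_sum m r (\<lambda>k. c k - d k)"
  by (simp add: coeff_sum_def case_prod_unfold sum_subtractf algebra_simps)

lemma coeff_coeff_sum:
  "coeff (coeff (coeff_sum m r c) j) i = (if i < m \<and> j < r then c (i, j) else 0)"
proof -
  have X: "varX ^ k = [:monom 1 k:]" for k
    by (simp add: varX_def poly_const_pow monom_altdef)
  have Y: "varY ^ l = monom 1 l" for l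
    by (simp add: varY_def monom_altdef)
  have "coeff (coeff (of_int z * varX ^ k * varY ^ l) j) i = (if (i, j) = (k, l) then z else 0)"
    for z k l
    by (simp add: X Y of_int_poly smult_monom coeff_monom)
  then have "coeff (coeff (coeff_sum m r c) j) i
      = (\<Sum>x\<in>index_set m r. if (i, j) = x then c x else 0)"
    by (simp add: coeff_sum_def coeff_sum case_prod_unfold del: prod.inject)
  also have "\<dots> = (if i < m \<and> j < r then c (i, j) else 0)"
    by (simp add: index_set_def)
  finally show ?thesis .
qed

lemma coeff_sum_eqI:
  assumes "degree P < r" and "\<And>j. degree (coeff P j) < m"
  shows "P = coeff_sum m r (\<lambda>(i, j). coeff (coeff P j) i)"
proof (intro poly_eqI)
  fix i j
  have "coeff (coeff P j) i = 0" if "\<not> (i < m \<and> j < r)"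
  proof (cases "j < r")
    case True
    with that have "degree (coeff P j) < i"
      using assms(2)[of j] by simp
    then show ?thesis
      by (rule coeff_eq_0)
  next
    case False
    with assms(1) show ?thesis
      by (simp add: coeff_eq_0)
  qed
  then show "coeff (coeff P j) i = coeff (coeff (coeff_sum m r (\<lambda>(i, j). coeff (coeff P j) i)) j) i"
    by (auto simp: coeff_coeff_sum)
qed

lemma coeff_sum_spans_mod_ideal_J:
  assumes "m > 0" and "r > 0"
  shows "\<exists>c. F - coeff_sum m r c \<in> ideal_J m r a"
proof -
  define u :: "int poly" where "u = [:0, 1:] ^ m + [:-1:]"
  define w :: int_poly2 where "w = [:0, 1:] ^ r + [:[:0, 1:] ^ r - of_int a:]"
  have deg: "degree u = m" "lead_coeff u = 1" "degree w = r" "lead_coeff w = 1"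
    unfolding u_def w_def
    by (intro degree_monom_plus_const lead_coeff_monom_plus_const assms)+
  obtain S R where SR: "F = w * S + R" "degree R < r"
    using monic_division[of w F] deg assms by metis
  have "\<exists>s h. coeff R j = u * s + h \<and> degree h < m" for j
    using monic_division[of u "coeff R j"] deg assms by metis
  then obtain s h where sh: "\<And>j. coeff R j = u * s j + h j" "\<And>j. degree (h j) < m"
    by metis
  \<comment> \<open>The remainders and the quotients of the Y-coefficients are reassembled. The sums
    stop at \<open>r\<close>, beyond which \<open>R\<close> has no coefficients, so reducing in X
    keeps the Y-degree below \<open>r\<close>.\<close>
  define P where "P = (\<Sum>j<r. monom (h j) j)"
  define T where "T = (\<Sum>j<r. monom (s j) j)"
  have "coeff P j = (if j < r then h j else 0)" for j
    by (simp add: P_def coeff_sum)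
  moreover have "degree P < r"
    unfolding P_def using assms(2)
    by (intro degree_sum_less) (auto intro: le_less_trans[OF degree_monom_le])
  ultimately have "P = coeff_sum m r (\<lambda>(i, j). coeff (coeff P j) i)"
    using sh(2) assms(1) by (intro coeff_sum_eqI) auto
  moreover have "R = [:u:] * T + P"
  proof (rule poly_eqI)
    fix j
    show "coeff R j = coeff ([:u:] * T + P) j"
      using SR(2) by (cases "j < r") (simp_all add: P_def T_def coeff_sum coeff_eq_0 flip: sh(1))
  qed
  then have "F - P = T * [:u:] + S * w"
    using SR(1) by simp
  then have "F - P \<in> ideal_J m r a"
    unfolding ideal_J_def ideal_gen_pair varX_power_minus_one ideal_J_generator u_def w_def by blast
  ultimately show ?thesis
    by metis
qed

text \<open>Independence of the monomials: a multiple of a monic polynomial that has smaller degree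
  than it must be 0. This is applied first to \<open>w\<close> in Y, then to \<open>u\<close> in X
  for each Y-coefficient.\<close>

lemma coeff_sum_in_ideal_J:
  assumes "coeff_sum m r c \<in> ideal_J m r a" and "m > 0" and "r > 0" and "i < m" and "j < r"
  shows "c (i, j) = 0"
proof -
  define u :: "int poly" where "u = [:0, 1:] ^ m + [:-1:]"
  define w :: int_poly2 where "w = [:0, 1:] ^ r + [:[:0, 1:] ^ r - of_int a:]"
  define P where "P = coeff_sum m r c"
  have deg: "degree u = m" "degree w = r" "lead_coeff w = 1"
    unfolding u_def w_def
    by (intro degree_monom_plus_const lead_coeff_monom_plus_const assms)+
  obtain s t where st: "P = s * [:u:] + t * w"
    using assms(1)
    unfolding ideal_J_def ideal_gen_pair varX_power_minus_one ideal_J_generator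
      u_def w_def P_def by blast
  \<comment> \<open>Reducing the cofactor of \<open>u\<close> modulo \<open>w\<close> moves the
    excess into the cofactor of \<open>w\<close>; what remains, \<open>smult u h\<close>, has
    Y-degree below \<open>r\<close>.\<close>
  obtain s' h where s': "s = w * s' + h" "degree h < r"
    using monic_division[of w s] deg assms by metis
  have P0: "coeff P k = 0" if "k \<ge> r" for k
    using that by (intro poly_eqI) (simp add: P_def coeff_coeff_sum)
  have "P - smult u h = w * (t + s' * [:u:])"
    by (simp add: st s' algebra_simps)
  moreover have "degree (P - smult u h) < r"
  proof -
    have "degree P < r"
      by (rule degree_lessI) (use P0 assms in auto)
    then show ?thesis
      using s'(2) by (intro degree_diff_less) (auto intro: le_less_trans[OF degree_smult_le])
  qed
  ultimately have "P - smult u h = 0"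
    using deg(2) by (metis degree_mult_eq leD le_add1 mult_eq_0_iff)
  then have dvd: "coeff P j = u * coeff h j"
    by simp
  have "degree (coeff P j) < m"
    by (rule degree_lessI) (use assms in \<open>auto simp: P_def coeff_coeff_sum\<close>)
  then have "coeff P j = 0"
    using dvd deg(1) by (metis degree_mult_eq leD le_add1 mult_eq_0_iff)
  then show ?thesis
    using coeff_coeff_sum[of m r c j i] assms by (simp add: P_def)
qed

section \<open>Existence and uniqueness of the coefficient family\<close>

lemma ideal_J_subset_ideal_I: "ideal_J m r a \<subseteq> ideal_I m r N a"
  unfolding ideal_J_def ideal_I_def by (rule ideal_gen_mono) auto

lemma coeff_sum_mult: "coeff_sum m r (\<lambda>k. d * c k) = of_int d * coeff_sum m r c"
  by (simp add: coeff_sum_def case_prod_unfold sum_distrib_left mult.assoc)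

lemma coeff_sum_cong:
  "(\<And>k. k \<in> index_set m r \<Longrightarrow> c k = d k) \<Longrightarrow> coeff_sum m r c = coeff_sum m r d"
  unfolding coeff_sum_def by (intro sum.cong) auto

lemma prime_dvd_power_mult_diff:
  fixes x y :: "'a::comm_ring_1"
  assumes "prime q"
  shows "of_nat q dvd (x + y) ^ (q * n) - (x ^ q + y ^ q) ^ n"
  using prime_dvd_add_power_diff[OF assms, of x y]
    diff_dvd_power_diff[of "(x + y) ^ q" "x ^ q + y ^ q" n]
  by (metis dvd_trans power_mult)

lemma ex1_coeff_family:
  assumes "prime q" and "N = p * q" and "m > 0" and "r > 0"
  shows "\<exists>!c. is_coeff_family p q N m r a c"
proof -
  let ?F = "(varX + varY) ^ N - (varX ^ q + varY ^ q) ^ p"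
  \<comment> \<open>The factor \<open>q\<close> is extracted before the reduction, so the
    coefficients of the normal form come out as multiples of \<open>q\<close>.\<close>
  obtain G where G: "?F = of_nat q * G"
    using prime_dvd_power_mult_diff[OF assms(1), of varX varY p] assms(2)
    by (metis dvdE mult.commute)
  obtain d where d: "G - coeff_sum m r d \<in> ideal_J m r a"
    using coeff_sum_spans_mod_ideal_J[OF assms(3,4)] by blast
  define c where "c = restrict (\<lambda>k. int q * d k) (index_set m r)"
  have "coeff_sum m r c = coeff_sum m r (\<lambda>k. int q * d k)"
    by (rule coeff_sum_cong) (simp add: c_def)
  then have "?F - coeff_sum m r c = of_nat q * (G - coeff_sum m r d)"
    by (simp add: coeff_sum_mult G right_diff_distrib)
  then have "?F - coeff_sum m r c \<in> ideal_J m r a"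
    using d unfolding ideal_J_def by (metis ideal_gen_mult)
  then have "is_coeff_family p q N m r a c"
    unfolding is_coeff_family_def by (auto simp: c_def)
  moreover have "c1 = c2"
    if "is_coeff_family p q N m r a c1" "is_coeff_family p q N m r a c2" for c1 c2
  proof -
    \<comment> \<open>Subtracting the two congruences eliminates \<open>?F\<close> and leaves a
      combination of independent monomials in \<open>ideal_J\<close>.\<close>
    have "(?F - coeff_sum m r c2) - (?F - coeff_sum m r c1) \<in> ideal_J m r a"
      using that unfolding is_coeff_family_def ideal_J_def by (blast intro: ideal_gen_diff)
    then have "coeff_sum m r (\<lambda>k. c1 k - c2 k) \<in> ideal_J m r a"
      by (simp flip: coeff_sum_diff)
    then have "c1 (i, j) - c2 (i, j) = 0" if "i < m" "j < r" for i j
      using coeff_sum_in_ideal_J that assms(3,4) by blast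
    then have "c1 k = c2 k" if "k \<in> index_set m r" for k
      using that by (auto simp: index_set_def)
    with that show ?thesis
      unfolding is_coeff_family_def by (blast intro: PiE_ext)
  qed
  ultimately show ?thesis
    by blast
qed

section \<open>Membership in \<open>ideal_I\<close>\<close>

lemma power_sum_diff_in_ideal_I:
  assumes "prime p" and "prime q" and "p \<noteq> q" and N: "N = p * q" and "r \<le> p" and "[p = r] (mod m)"
    and hyp: "(varX + varY) ^ N - of_int (a ^ q) \<in> ideal_I m r N a"
  shows "(varX ^ q + varY ^ q) ^ p - varX ^ N - varY ^ N \<in> ideal_I m r N a"
    (is "?E \<in> ?I")
proof -
  have I_add: "x + y \<in> ?I" if "x \<in> ?I" "y \<in> ?I" for x y
    using that unfolding ideal_I_def by (rule ideal_gen_add)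
  have I_diff: "x - y \<in> ?I" if "x \<in> ?I" "y \<in> ?I" for x y
    using that unfolding ideal_I_def by (rule ideal_gen_diff)
  have I_dvd: "y \<in> ?I" if "x \<in> ?I" "x dvd y" for x y
    using that unfolding ideal_I_def by (rule ideal_gen_dvd)
  have gens: "varX ^ m - 1 \<in> ?I" "varY ^ m - 1 \<in> ?I"
    "varX ^ r + varY ^ r - of_int a \<in> ?I" "of_nat N \<in> ?I"
    unfolding ideal_I_def by (auto intro: ideal_gen_base)
  \<comment> \<open>Since \<open>r \<le> p\<close>, the multiplier \<open>k\<close> is a natural
    number and can serve as an exponent.\<close>
  obtain k where k: "p = r + m * k"
    using assms(5,6) by (metis cong_le_nat cong_sym mult.commute add.commute)
  have reduce: "z ^ p - z ^ r \<in> ?I" if "z ^ m - 1 \<in> ?I" for z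
  proof -
    have "z ^ m - 1 dvd (z ^ m) ^ k - 1"
      using diff_dvd_power_diff[of "z ^ m" 1 k] by simp
    then have "z ^ m - 1 dvd z ^ r * ((z ^ m) ^ k - 1)"
      by (rule dvd_mult)
    also have "\<dots> = z ^ p - z ^ r"
      by (simp add: k power_add power_mult right_diff_distrib)
    finally show ?thesis
      using that I_dvd by blast
  qed
  have "(varX ^ p - varX ^ r) + (varY ^ p - varY ^ r) + (varX ^ r + varY ^ r - of_int a) \<in> ?I"
    by (intro I_add reduce gens)
  then have "varX ^ p + varY ^ p - of_int a \<in> ?I"
    by (simp add: algebra_simps)
  then have Ia: "(varX ^ p + varY ^ p) ^ q - of_int (a ^ q) \<in> ?I"
    using I_dvd diff_dvd_power_diff[of "varX ^ p + varY ^ p" "of_int a" q] by simp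
  obtain G where G: "?E = of_nat p * G"
  proof -
    have "of_nat p dvd ?E"
      using prime_dvd_add_power_diff[OF assms(1), of "varX ^ q" "varY ^ q"]
      by (simp add: N mult.commute diff_diff_eq flip: power_mult)
    then show ?thesis
      using that by (auto elim: dvdE)
  qed
  obtain H1 where H1: "(varX + varY) ^ N - (varX ^ q + varY ^ q) ^ p = of_nat q * H1"
    using prime_dvd_power_mult_diff[OF assms(2), of varX varY p] N
    by (metis dvdE mult.commute)
  obtain H2 where H2: "(varX ^ p + varY ^ p) ^ q - (varX ^ N + varY ^ N) = of_nat q * H2"
    using prime_dvd_add_power_diff[OF assms(2), of "varX ^ p" "varY ^ p"] N
    by (metis dvdE power_mult)
  \<comment> \<open>Comparing the orders of taking the \<open>p\<close>-th and \<open>q\<close>-th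
    powers gives this identity. The last two differences lie in \<open>?I\<close>, by
    \<open>hyp\<close> and \<open>Ia\<close>, so \<open>?E\<close> is a multiple of \<open>q\<close>
    modulo \<open>?I\<close>.\<close>
  have E: "?E = of_nat q * (H2 - H1) + ((varX + varY) ^ N - of_int (a ^ q))
      - ((varX ^ p + varY ^ p) ^ q - of_int (a ^ q))"
    by (simp add: right_diff_distrib flip: H1 H2)
  have "of_nat q * ?E = of_nat N * G"
    by (subst G) (simp add: N)
  then have qE: "of_nat q * ?E \<in> ?I"
    using I_dvd[OF gens(4)] by simp
  have "of_nat p * ?E = of_nat N * (H2 - H1)
      + of_nat p * (((varX + varY) ^ N - of_int (a ^ q)) - ((varX ^ p + varY ^ p) ^ q - of_int (a ^ q)))"
    by (subst E) (simp add: N algebra_simps)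
  also have "\<dots> \<in> ?I"
    by (intro I_add I_dvd[OF gens(4)] I_dvd[OF I_diff[OF hyp Ia]]) simp_all
  finally have pE: "of_nat p * ?E \<in> ?I" .
  \<comment> \<open>A Bezout identity recovers \<open>?E\<close> from its multiples by
    \<open>p\<close> and by \<open>q\<close>.\<close>
  have "coprime (int p) (int q)"
    using assms(1-3) by (simp add: primes_coprime)
  then obtain u v where "u * int p + v * int q = 1"
    by (metis bezout_int coprime_iff_gcd_eq_1)
  then have "of_int u * of_nat p + of_int v * of_nat q = (1 :: int_poly2)"
    by (metis of_int_1 of_int_add of_int_mult of_int_of_nat_eq)
  then have "?E = (of_int u * of_nat p + of_int v * of_nat q) * ?E"
    by simp
  also have "\<dots> = of_int u * (of_nat p * ?E) + of_int v * (of_nat q * ?E)"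
    by (simp only: distrib_right mult.assoc)
  also have "\<dots> \<in> ?I"
    by (intro I_add I_dvd[OF pE] I_dvd[OF qE]) simp_all
  finally show ?thesis .
qed

lemma coeff_sum_in_ideal_I:
  assumes "\<And>k. k \<in> index_set m r \<Longrightarrow> int N dvd c k"
  shows "coeff_sum m r c \<in> ideal_I m r N a"
proof -
  have "coeff_sum m r c = coeff_sum m r (\<lambda>k. int N * (c k div int N))"
    using assms by (intro coeff_sum_cong) simp
  also have "\<dots> = of_nat N * coeff_sum m r (\<lambda>k. c k div int N)"
    by (simp add: coeff_sum_mult)
  finally show ?thesis
    unfolding ideal_I_def by (auto intro: ideal_gen_dvd[OF ideal_gen_base])
qed

theorem proposition4p6:
  fixes p q N m r :: nat and a :: int
  assumes "prime p" and "prime q" and "p \<noteq> q" and "p \<ge> 3"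
    and "N = p * q"
    and "1 < m" and "m < p"
    and "r \<in> {1..m - 1}" and "[p = r] (mod m)"
  shows "(\<exists>!c. is_coeff_family p q N m r a c) \<and>
    (\<forall>c. is_coeff_family p q N m r a c \<longrightarrow>
      ((varX + varY) ^ N - of_int (a ^ q) \<in> ideal_I m r N a \<longrightarrow>
        (varX + varY) ^ N - varX ^ N - varY ^ N - coeff_sum m r c \<in> ideal_I m r N a) \<and>
      ((varX + varY) ^ N - of_int (a ^ q) \<in> ideal_I m r N a \<and>
        (varX + varY) ^ N - varX ^ N - varY ^ N \<notin> ideal_I m r N a \<longrightarrow>
        (\<exists>(i0, j0)\<in>index_set m r. gcd (c (i0, j0)) (int N) = int q)))"
proof (intro conjI allI impI)
  show "\<exists>!c. is_coeff_family p q N m r a c"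
    using assms by (intro ex1_coeff_family) auto
next
  fix c
  let ?I = "ideal_I m r N a"
  let ?D = "(varX + varY) ^ N - varX ^ N - varY ^ N"
  assume c: "is_coeff_family p q N m r a c"
  show congruence: "?D - coeff_sum m r c \<in> ?I"
    if "(varX + varY) ^ N - of_int (a ^ q) \<in> ?I"
  proof -
    have "(varX ^ q + varY ^ q) ^ p - varX ^ N - varY ^ N \<in> ?I"
      using assms that by (intro power_sum_diff_in_ideal_I) auto
    moreover have "(varX + varY) ^ N - (varX ^ q + varY ^ q) ^ p - coeff_sum m r c \<in> ?I"
      using c unfolding is_coeff_family_def by (auto intro: subsetD[OF ideal_J_subset_ideal_I])
    \<comment> \<open>Adding the two memberships cancels
      \<open>(varX ^ q + varY ^ q) ^ p\<close>.\<close>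
    ultimately show ?thesis
      unfolding ideal_I_def by (auto dest: ideal_gen_add simp: algebra_simps)
  qed
  assume "(varX + varY) ^ N - of_int (a ^ q) \<in> ?I \<and> ?D \<notin> ?I"
  then have "coeff_sum m r c \<notin> ?I"
    using congruence ideal_gen_add unfolding ideal_I_def by (metis diff_add_cancel)
  then obtain k where k: "k \<in> index_set m r" "\<not> int N dvd c k"
    using coeff_sum_in_ideal_I by blast
  moreover obtain z where z: "c k = int q * z"
    using c k(1) unfolding is_coeff_family_def by (auto elim!: PiE_E dvdE)
  \<comment> \<open>As \<open>p * q\<close> does not divide \<open>q * z\<close>, the prime
    \<open>p\<close> does not divide \<open>z\<close>; the gcd is then
    \<open>q * gcd z p = q\<close>.\<close>
  ultimately have "coprime (int p) z"
    using assms by (auto intro!: prime_imp_coprime)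
  then have "gcd (c k) (int N) = int q"
    using z assms(5)
    by (simp add: gcd_mult_left coprime_iff_gcd_eq_1 gcd.commute mult.commute[of "int p"])
  with k(1) show "\<exists>(i0, j0)\<in>index_set m r. gcd (c (i0, j0)) (int N) = int q"
    by auto
qed

end
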